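(* Let $\mathcal C$ be a class of probability distributions over $\{0,1\}^n$ such that (1) the uniform distribution on $\{0,1\}^n$ belongs to $\mathcal C$, and (2) there is a learning algorithm for $\mathcal C$ with sample complexity $m=m(n,\varepsilon)$, i.e., given $m$ i.i.d. samples from any $P\in\mathcal C$ it outputs a distribution $H$ with $d_{\mathrm{TV}}(H,P)<\varepsilon$ with probability at least $2/3$. Then, as long as $mn\ll 2^{O(n)}$ (that is, $mn\le 2^{\rho n}$ for a suitably small absolute constant $\rho>0$), any algorithm that distinguishes with probability at least $2/3$ whether an arbitrary distribution over $\{0,1\}^n$ belongs to $\mathcal C$ or is $\varepsilon$-far in total variation distance from every distribution in $\mathcal C$ requires $\Omega(2^{n/2}/\varepsilon^2)$ samples.
   Context: $d_{\mathrm{TV}}(P,Q)=\frac12\sum_x|P(x)-Q(x)|$; "$\varepsilon$-far from $\mathcal C$" means $d_{\mathrm{TV}}(P,Q)\ge\varepsilon$ for all $Q\in\mathcal C$. *)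

theory Defs
  imports "HOL-Probability.Probability"
begin

definition cube :: "nat \<Rightarrow> bool list set" where
  "cube n = {x. length x = n}"

definition dists :: "nat \<Rightarrow> bool list pmf set" where
  "dists n = {P. set_pmf P \<subseteq> cube n}"

(* Only meaningful for P, Q in dists n, since mass outside the cube is not counted. *)
definition dTV :: "nat \<Rightarrow> bool list pmf \<Rightarrow> bool list pmf \<Rightarrow> real" where
  "dTV n P Q = (1/2) * (\<Sum>x\<in>cube n. \<bar>pmf P x - pmf Q x\<bar>)"

definition far_from :: "nat \<Rightarrow> real \<Rightarrow> bool list pmf \<Rightarrow> bool list pmf set \<Rightarrow> bool" where
  "far_from n \<epsilon> P C \<longleftrightarrow> (\<forall>Q\<in>C. dTV n P Q \<ge> \<epsilon>)"

(* Algorithms are randomized: L maps the observed sample list to the law of the output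
   hypothesis.  In "bind_pmf (replicate_pmf m P) L" the probability is therefore taken over both
   the m i.i.d. samples from P and the internal coins of L. *)
definition learner ::
  "nat \<Rightarrow> bool list pmf set \<Rightarrow> real \<Rightarrow> nat \<Rightarrow> (bool list list \<Rightarrow> bool list pmf pmf) \<Rightarrow> bool" where
  "learner n C \<epsilon> m L \<longleftrightarrow>
     (\<forall>xs. length xs = m \<and> set xs \<subseteq> cube n \<longrightarrow> set_pmf (L xs) \<subseteq> dists n) \<and>
     (\<forall>P\<in>C. measure_pmf.prob (bind_pmf (replicate_pmf m P) L) {H. dTV n H P < \<epsilon>} \<ge> 2/3)"

(* The output True means "P belongs to C", False means "P is far from C"; nothing is required
   of T on distributions that are neither. *)
definition tester ::
  "nat \<Rightarrow> bool list pmf set \<Rightarrow> real \<Rightarrow> nat \<Rightarrow> (bool list list \<Rightarrow> bool pmf) \<Rightarrow> bool" where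
  "tester n C \<epsilon> q T \<longleftrightarrow>
     (\<forall>P\<in>dists n.
        (P \<in> C \<longrightarrow> pmf (bind_pmf (replicate_pmf q P) T) True \<ge> 2/3) \<and>
        (far_from n \<epsilon> P C \<longrightarrow> pmf (bind_pmf (replicate_pmf q P) T) False \<ge> 2/3))"

end

theory Submission
  imports Defs
begin

text \<open>
  A learner forces \<open>C\<close> to have small metric entropy: every \<open>Q \<in> C\<close> has a sample list on which the
  learner outputs a hypothesis close to \<open>Q\<close> with probability above \<open>1/2\<close>, and members of \<open>C\<close>
  sharing that list are close to each other, so at most \<open>2^(mn)\<close> small balls cover \<open>C\<close>.
  The uniform distribution is perturbed to \<open>(1 \<plusminus> \<delta>)/2^n\<close>, with \<open>\<delta> = 32\<epsilon>\<close> and opposite signs on the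
  two points of each of the \<open>2^(n-1)\<close> pairs (Paninski's family).  A Hamming ball bound shows that all
  but a small fraction of the sign choices give distributions far from \<open>C\<close>, so a tester must
  tell the uniform distribution from the mixture over all sign choices.  The chi-square divergence
  of the mixture of \<open>q\<close>-fold products is at most \<open>exp((q\<delta>\<^sup>2)\<^sup>2 / 2^n) - 1\<close>, which is tiny unless \<open>q\<close> is of
  order \<open>2^(n/2)/\<epsilon>\<^sup>2\<close>.  For \<open>n \<le> 7\<close> the choice \<open>\<rho> = 1/8\<close> gives \<open>mn \<le> 1\<close>, and a single perturbation
  is enough.
\<close>

section \<open>Sample lists, product laws and total variation on the cube\<close>

definition samples :: "nat \<Rightarrow> nat \<Rightarrow> bool list list set" where
  "samples n q = {xs. set xs \<subseteq> cube n \<and> length xs = q}"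

lemma finite_cube [simp]: "finite (cube n)"
  using finite_lists_length_eq[of "UNIV :: bool set" n] by (simp add: cube_def)

lemma card_cube [simp]: "card (cube n) = 2 ^ n"
  using card_lists_length_eq[of "UNIV :: bool set" n] by (simp add: cube_def)

lemma cube_nonempty [simp]: "cube n \<noteq> {}"
  by (metis card_cube card.empty power_not_zero zero_neq_numeral)

lemma finite_samples [simp]: "finite (samples n q)"
  unfolding samples_def by (rule finite_lists_length_eq) simp

lemma card_samples: "card (samples n q) = 2 ^ (n * q)"
  unfolding samples_def by (simp add: card_lists_length_eq power_mult)

lemma cube_Suc: "cube (Suc k) = Cons True ` cube k \<union> Cons False ` cube k"
proof -
  have "x \<in> Cons True ` cube k \<union> Cons False ` cube k" if "length x = Suc k" for x
    using that by (cases x; cases "hd x") (auto simp: cube_def)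
  then show ?thesis by (auto simp: cube_def)
qed

lemma sum_cube_Suc:
  "(\<Sum>x\<in>cube (Suc k). f x) = (\<Sum>y\<in>cube k. f (True # y) + f (False # y))" for f :: "_ \<Rightarrow> real"
proof -
  have "(\<Sum>x\<in>cube (Suc k). f x) = (\<Sum>x\<in>Cons True ` cube k. f x) + (\<Sum>x\<in>Cons False ` cube k. f x)"
    unfolding cube_Suc by (rule sum.union_disjoint) auto
  then show ?thesis by (simp add: sum.reindex inj_on_def sum.distrib)
qed

text \<open>Used twice in \<open>tester_chi_square_ge\<close>: with \<open>h = pmf R\<close> it says
  that product laws have mass 1, and with \<open>h\<close> a scaled product of two masses it turns a
  chi-square sum over lists into a \<open>q\<close>-th power.\<close>

lemma sum_samples_prod_list:
  fixes h :: "bool list \<Rightarrow> real"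
  shows "(\<Sum>xs\<in>samples n q. prod_list (map h xs)) = (\<Sum>x\<in>cube n. h x) ^ q"
proof (induction q)
  case 0
  have "samples n 0 = {[]}" by (auto simp: samples_def)
  then show ?case by simp
next
  case (Suc q)
  have eq: "samples n (Suc q) = (\<lambda>(x, xs). x # xs) ` (cube n \<times> samples n q)"
    by (force simp: samples_def length_Suc_conv)
  have "(\<Sum>xs\<in>samples n (Suc q). prod_list (map h xs))
      = (\<Sum>(x, xs)\<in>cube n \<times> samples n q. h x * prod_list (map h xs))"
    unfolding eq by (subst sum.reindex) (auto simp: inj_on_def intro!: sum.cong)
  also have "\<dots> = (\<Sum>x\<in>cube n. h x) * (\<Sum>xs\<in>samples n q. prod_list (map h xs))"
    by (simp add: sum_product sum.cartesian_product)
  finally show ?case using Suc by simp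
qed

lemma pmf_replicate_pmf:
  "length xs = q \<Longrightarrow> pmf (replicate_pmf q P) xs = prod_list (map (pmf P) xs)"
proof (induction q arbitrary: xs)
  case (Suc q)
  then obtain y ys where xs: "xs = y # ys" "length ys = q" by (auto simp: length_Suc_conv)
  have "replicate_pmf (Suc q) P = map_pmf (\<lambda>(x, xs). x # xs) (pair_pmf P (replicate_pmf q P))"
    by (simp add: pair_pmf_def map_bind_pmf map_return_pmf)
  moreover have "pmf (map_pmf (\<lambda>(x, xs). x # xs) M) ((\<lambda>(x, xs). x # xs) (y, ys)) = pmf M (y, ys)"
    for M :: "('a \<times> 'a list) pmf"
    by (rule pmf_map_inj') (auto simp: inj_def)
  ultimately have "pmf (replicate_pmf (Suc q) P) (y # ys) = pmf P y * pmf (replicate_pmf q P) ys"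
    by (simp add: pmf_pair)
  then show ?case using Suc.IH[of ys] xs by simp
qed simp

lemma set_replicate_pmf_subset: "P \<in> dists n \<Longrightarrow> set_pmf (replicate_pmf q P) \<subseteq> samples n q"
  by (auto simp: set_replicate_pmf samples_def dists_def)

lemma pmf_bind_replicate_pmf:
  assumes "P \<in> dists n"
  shows "pmf (bind_pmf (replicate_pmf q P) T) b
       = (\<Sum>xs\<in>samples n q. prod_list (map (pmf P) xs) * pmf (T xs) b)"
proof -
  have "pmf (bind_pmf (replicate_pmf q P) T) b
      = (\<Sum>xs\<in>samples n q. pmf (T xs) b * pmf (replicate_pmf q P) xs)"
    unfolding pmf_bind using set_replicate_pmf_subset[OF assms]
    by (intro integral_measure_pmf_real) auto
  also have "\<dots> = (\<Sum>xs\<in>samples n q. prod_list (map (pmf P) xs) * pmf (T xs) b)"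
    by (intro sum.cong) (auto simp: pmf_replicate_pmf samples_def)
  finally show ?thesis .
qed

lemma sum_pmf_cube: "P \<in> dists n \<Longrightarrow> (\<Sum>x\<in>cube n. pmf P x) = 1"
  by (rule sum_pmf_eq_1) (auto simp: dists_def)

lemma uniform_in_dists: "pmf_of_set (cube n) \<in> dists n"
  by (simp add: dists_def)

lemma dTV_commute: "dTV n P Q = dTV n Q P"
  by (simp add: dTV_def abs_minus_commute)

lemma dTV_triangle: "dTV n P R \<le> dTV n P Q + dTV n Q R"
proof -
  have "(\<Sum>x\<in>cube n. \<bar>pmf P x - pmf R x\<bar>)
      \<le> (\<Sum>x\<in>cube n. \<bar>pmf P x - pmf Q x\<bar> + \<bar>pmf Q x - pmf R x\<bar>)"
    by (intro sum_mono) linarith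
  then show ?thesis by (simp add: dTV_def sum.distrib)
qed

section \<open>Two analytic inequalities\<close>

text \<open>The right-hand side is the chi-square divergence of the uniform mixture of the
  \<open>p z\<close> from \<open>u\<close>, with the square of the mixture expanded into pairs
  \<open>z\<close>, \<open>z'\<close>. Cauchy-Schwarz bounds by it the squared change in the
  expectation of any \<open>f\<close> with values in [0, 1].\<close>

lemma mixture_chi_square_bound:
  fixes p :: "'z \<Rightarrow> 'a \<Rightarrow> real" and u f :: "'a \<Rightarrow> real"
  assumes "finite W" "finite Z" "Z \<noteq> {}"
    and u: "\<And>x. x \<in> W \<Longrightarrow> u x > 0" "(\<Sum>x\<in>W. u x) = 1"
    and p: "\<And>z. z \<in> Z \<Longrightarrow> (\<Sum>x\<in>W. p z x) = 1"
    and f: "\<And>x. x \<in> W \<Longrightarrow> 0 \<le> f x \<and> f x \<le> 1"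
  shows "((\<Sum>z\<in>Z. \<Sum>x\<in>W. p z x * f x) / card Z - (\<Sum>x\<in>W. u x * f x))\<^sup>2
       \<le> (\<Sum>z\<in>Z. \<Sum>z'\<in>Z. \<Sum>x\<in>W. p z x * p z' x / u x) / (real (card Z))\<^sup>2 - 1"
proof -
  define g where "g x = (\<Sum>z\<in>Z. p z x) / card Z" for x
  have cZ: "real (card Z) > 0" using assms by (simp add: card_gt_0_iff)
  have gf: "(\<Sum>z\<in>Z. \<Sum>x\<in>W. p z x * f x) / card Z = (\<Sum>x\<in>W. g x * f x)"
    unfolding g_def by (subst sum.swap) (simp add: sum_distrib_right sum_divide_distrib)
  have g1: "(\<Sum>x\<in>W. g x) = 1"
    unfolding g_def using cZ p by (simp add: sum_divide_distrib[symmetric] sum.swap[of _ Z W])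
  have g2: "(\<Sum>z\<in>Z. \<Sum>z'\<in>Z. \<Sum>x\<in>W. p z x * p z' x / u x) / (real (card Z))\<^sup>2
      = (\<Sum>x\<in>W. (g x)\<^sup>2 / u x)"
  proof -
    have "(\<Sum>z\<in>Z. \<Sum>z'\<in>Z. \<Sum>x\<in>W. p z x * p z' x / u x)
        = (\<Sum>x\<in>W. \<Sum>z\<in>Z. \<Sum>z'\<in>Z. p z x * p z' x / u x)"
      by (subst sum.swap[of _ W Z]) (intro sum.cong refl sum.swap)
    also have "\<dots> = (\<Sum>x\<in>W. (\<Sum>z\<in>Z. p z x)\<^sup>2 / u x)"
      by (simp add: power2_eq_square sum_product sum_divide_distrib)
    finally show ?thesis
      by (simp add: g_def power_divide mult.commute sum_divide_distrib[of _ _ "(real (card Z))\<^sup>2"])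
  qed
  \<comment> \<open>Splitting off the weight \<open>sqrt (u x)\<close> makes the first
    Cauchy-Schwarz factor the chi-square divergence and the second the \<open>u\<close>-mean of
    \<open>f\<close> squared, which is at most 1.\<close>
  have "(\<Sum>x\<in>W. g x * f x) - (\<Sum>x\<in>W. u x * f x)
      = (\<Sum>x\<in>W. ((g x - u x) / sqrt (u x)) * (sqrt (u x) * f x))"
    unfolding sum_subtractf[symmetric]
    using u(1) by (intro sum.cong) (auto simp: field_simps dest!: less_imp_neq[OF u(1)])
  then have "((\<Sum>x\<in>W. g x * f x) - (\<Sum>x\<in>W. u x * f x))\<^sup>2
      \<le> (\<Sum>x\<in>W. ((g x - u x) / sqrt (u x))\<^sup>2) * (\<Sum>x\<in>W. (sqrt (u x) * f x)\<^sup>2)"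
    by (simp only:) (rule Cauchy_Schwarz_ineq_sum)
  also have "\<dots> \<le> (\<Sum>x\<in>W. ((g x - u x) / sqrt (u x))\<^sup>2) * 1"
  proof (intro mult_left_mono sum_nonneg)
    have "(\<Sum>x\<in>W. (sqrt (u x) * f x)\<^sup>2) \<le> (\<Sum>x\<in>W. u x)"
    proof (rule sum_mono)
      fix x assume x: "x \<in> W"
      have "(sqrt (u x) * f x)\<^sup>2 = u x * (f x)\<^sup>2"
        using u(1)[OF x] by (simp add: power_mult_distrib)
      also have "\<dots> \<le> u x * 1"
        using u(1)[OF x] f[OF x] by (intro mult_left_mono) (auto simp: power_le_one)
      finally show "(sqrt (u x) * f x)\<^sup>2 \<le> u x" by simp
    qed
    then show "(\<Sum>x\<in>W. (sqrt (u x) * f x)\<^sup>2) \<le> 1" using u by simp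
  qed simp
  also have "\<dots> = (\<Sum>x\<in>W. (g x)\<^sup>2 / u x - 2 * g x + u x)"
  proof -
    have "((g x - u x) / sqrt (u x))\<^sup>2 * 1 = (g x)\<^sup>2 / u x - 2 * g x + u x" if "x \<in> W" for x
      using u(1)[OF that] by (simp add: power_divide power2_eq_square field_simps)
    then show ?thesis by (simp add: sum_distrib_right)
  qed
  also have "\<dots> = (\<Sum>x\<in>W. (g x)\<^sup>2 / u x) - 1"
    using g1 u(2) by (simp add: sum.distrib sum_subtractf sum_distrib_left[symmetric])
  finally show ?thesis unfolding gf g2 .
qed

text \<open>Hoeffding's lemma for a fair sign: at probability 1/2 and width \<open>2 * y\<close> its
  left side is the logarithm of cosh y. Evenness in \<open>x\<close> reduces the claim to
  \<open>y \<ge> 0\<close>.\<close>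

lemma cosh_le_exp_square:
  fixes x :: real
  shows "exp x + exp (- x) \<le> 2 * exp (x\<^sup>2 / 2)"
proof -
  have *: "exp y + exp (- y) \<le> 2 * exp (y\<^sup>2 / 2)" if "y \<ge> 0" for y :: real
  proof -
    have pos: "1 + (1/2) * (exp (2 * y) - 1) > 0" using exp_gt_zero[of "2*y"] by (simp add: field_simps add_pos_pos)
    have "- y + ln (1 + (1/2) * (exp (2 * y) - 1)) \<le> y\<^sup>2 / 2"
      using Hoeffdings_lemma_aux[of "2 * y" "1/2"] that by (simp add: power2_eq_square)
    then have "exp (- y) * exp (ln (1 + (1/2) * (exp (2 * y) - 1))) \<le> exp (y\<^sup>2 / 2)"
      unfolding exp_add[symmetric] by simp
    then have "exp (- y) * (1 + (1/2) * (exp (2 * y) - 1)) \<le> exp (y\<^sup>2 / 2)"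
      using pos by simp
    moreover have "exp (- y) * exp (2 * y) = exp y" by (simp add: exp_add[symmetric])
    ultimately show ?thesis by (simp add: algebra_simps)
  qed
  show ?thesis using *[of x] *[of "- x"] by (cases "x \<ge> 0") (auto simp: add.commute)
qed

section \<open>Paninski's family and its second moment\<close>

definition sgn_in :: "'a set \<Rightarrow> 'a \<Rightarrow> real" where
  "sgn_in S y = (if y \<in> S then 1 else -1)"

text \<open>The tail of a string names its pair and the head says which of the two points it is, so
  a sign vector on the pairs is a subset of \<open>cube k\<close>.\<close>

definition perturbed :: "nat \<Rightarrow> real \<Rightarrow> bool list set \<Rightarrow> bool list pmf" where
  "perturbed k \<delta> S = embed_pmf (\<lambda>x. if x \<in> cube (Suc k)
     then (1 + (if hd x then \<delta> else - \<delta>) * sgn_in S (tl x)) / 2 ^ Suc k else 0)"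

text \<open>The bounds on \<delta> keep the masses nonnegative, and the two deviations in a pair
  cancel, so \<open>embed_pmf\<close> receives a genuine probability mass function.\<close>

lemma pmf_perturbed:
  assumes "0 \<le> \<delta>" "\<delta> \<le> 1"
  shows "pmf (perturbed k \<delta> S) x = (if x \<in> cube (Suc k)
     then (1 + (if hd x then \<delta> else - \<delta>) * sgn_in S (tl x)) / 2 ^ Suc k else 0)" (is "_ = ?f x")
  unfolding perturbed_def
proof (rule pmf_embed_pmf)
  show nonneg: "0 \<le> ?f x" for x
    using assms by (auto simp: sgn_in_def)
  have "(\<integral>\<^sup>+ x. ennreal (?f x) \<partial>count_space UNIV) = (\<Sum>x\<in>cube (Suc k). ennreal (?f x))"
    by (rule nn_integral_count_space') auto
  also have "\<dots> = ennreal (\<Sum>x\<in>cube (Suc k). ?f x)"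
    by (rule sum_ennreal) (rule nonneg)
  also have "(\<Sum>x\<in>cube (Suc k). ?f x) = (\<Sum>y\<in>cube k. 2 / 2 ^ Suc k)"
    unfolding sum_cube_Suc by (intro sum.cong) (auto simp: cube_def add_divide_distrib[symmetric])
  also have "\<dots> = 1" by simp
  finally show "(\<integral>\<^sup>+ x. ennreal (?f x) \<partial>count_space UNIV) = 1" by simp
qed

lemma pmf_perturbed_Cons:
  assumes "0 \<le> \<delta>" "\<delta> \<le> 1" "y \<in> cube k"
  shows "pmf (perturbed k \<delta> S) (b # y) = (1 + (if b then \<delta> else - \<delta>) * sgn_in S y) / 2 ^ Suc k"
  using assms by (simp add: pmf_perturbed cube_def)

lemma perturbed_in_dists: "0 \<le> \<delta> \<Longrightarrow> \<delta> \<le> 1 \<Longrightarrow> perturbed k \<delta> S \<in> dists (Suc k)"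
  by (auto simp: dists_def set_pmf_eq pmf_perturbed split: if_splits)

lemma dTV_perturbed_uniform:
  assumes "0 \<le> \<delta>" "\<delta> \<le> 1"
  shows "dTV (Suc k) (pmf_of_set (cube (Suc k))) (perturbed k \<delta> S) = \<delta> / 2"
proof -
  have "\<bar>1 / 2 ^ Suc k - pmf (perturbed k \<delta> S) (b # y)\<bar> = \<delta> / 2 ^ Suc k" if "y \<in> cube k" for b y
    unfolding pmf_perturbed_Cons[OF assms that] diff_divide_distrib[symmetric]
    using assms by (simp add: sgn_in_def)
  moreover have "b # y \<in> cube (Suc k)" if "y \<in> cube k" for b y
    using that by (simp add: cube_def)
  ultimately show ?thesis by (simp add: dTV_def sum_cube_Suc)
qed

text \<open>Total variation is a scaled Hamming distance: a pair with different signs changes both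
  its masses by \<delta> / 2^k, and the factor 1/2 leaves \<delta> / 2^k per pair.\<close>

lemma dTV_perturbed:
  assumes "0 \<le> \<delta>" "\<delta> \<le> 1"
  shows "dTV (Suc k) (perturbed k \<delta> S) (perturbed k \<delta> S')
       = \<delta> * card {y\<in>cube k. (y \<in> S) \<noteq> (y \<in> S')} / 2 ^ k"
proof -
  have "\<bar>pmf (perturbed k \<delta> S) (b # y) - pmf (perturbed k \<delta> S') (b # y)\<bar>
      = (if (y \<in> S) \<noteq> (y \<in> S') then \<delta> / 2 ^ k else 0)" if "y \<in> cube k" for b y
    using that assms by (simp add: pmf_perturbed_Cons sgn_in_def diff_divide_distrib[symmetric])
  then have "dTV (Suc k) (perturbed k \<delta> S) (perturbed k \<delta> S')
      = (\<Sum>y\<in>cube k. if (y \<in> S) \<noteq> (y \<in> S') then \<delta> / 2 ^ k else 0)"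
    by (simp add: dTV_def sum_cube_Suc sum_distrib_left)
  also have "\<dots> = \<delta> * card {y\<in>cube k. (y \<in> S) \<noteq> (y \<in> S')} / 2 ^ k"
    by (subst sum.inter_filter[symmetric]) simp_all
  finally show ?thesis .
qed

text \<open>The terms linear in \<delta> cancel within each pair, so only the correlation of the two
  sign vectors survives.\<close>

lemma perturbed_inner_product:
  assumes "0 \<le> \<delta>" "\<delta> \<le> 1"
  shows "2 ^ Suc k * (\<Sum>x\<in>cube (Suc k). pmf (perturbed k \<delta> S) x * pmf (perturbed k \<delta> S') x)
       = 1 + \<delta>\<^sup>2 * (\<Sum>y\<in>cube k. sgn_in S y * sgn_in S' y) / 2 ^ k"
proof -
  have "(\<Sum>x\<in>cube (Suc k). pmf (perturbed k \<delta> S) x * pmf (perturbed k \<delta> S') x)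
      = (\<Sum>y\<in>cube k. (1 + \<delta>\<^sup>2 * (sgn_in S y * sgn_in S' y)) / (2 ^ k * 2 ^ Suc k))"
    unfolding sum_cube_Suc using assms
    by (intro sum.cong) (auto simp: pmf_perturbed_Cons field_simps power2_eq_square)
  also have "\<dots> = (\<Sum>y\<in>cube k. 1 + \<delta>\<^sup>2 * (sgn_in S y * sgn_in S' y)) / (2 ^ k * 2 ^ Suc k)"
    by (rule sum_divide_distrib[symmetric])
  also have "(\<Sum>y\<in>cube k. 1 + \<delta>\<^sup>2 * (sgn_in S y * sgn_in S' y))
      = 2 ^ k + \<delta>\<^sup>2 * (\<Sum>y\<in>cube k. sgn_in S y * sgn_in S' y)"
    by (simp add: sum.distrib sum_distrib_left)
  finally show ?thesis by (simp add: field_simps)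
qed

lemma perturbed_inner_product_power_le:
  assumes "0 \<le> \<delta>" "\<delta> \<le> 1"
  shows "(2 ^ Suc k * (\<Sum>x\<in>cube (Suc k). pmf (perturbed k \<delta> S) x * pmf (perturbed k \<delta> S') x)) ^ q
       \<le> exp (real q * \<delta>\<^sup>2 / 2 ^ k * (\<Sum>y\<in>cube k. sgn_in S y * sgn_in S' y))"
proof -
  define t where "t = \<delta>\<^sup>2 * (\<Sum>y\<in>cube k. sgn_in S y * sgn_in S' y) / 2 ^ k"
  \<comment> \<open>Raising \<open>1 + t \<le> exp t\<close> to the power \<open>q\<close> needs a
    nonnegative base; here it is a scaled sum of products of masses.\<close>
  have nonneg: "0 \<le> 1 + t"
    unfolding t_def perturbed_inner_product[OF assms, symmetric]
    by (intro mult_nonneg_nonneg sum_nonneg) auto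
  have "(1 + t) ^ q \<le> exp t ^ q" using nonneg by (intro power_mono) auto
  also have "\<dots> = exp (real q * t)" by (rule exp_of_nat_mult[symmetric])
  finally show ?thesis unfolding perturbed_inner_product[OF assms] t_def by (simp add: mult.assoc)
qed

lemma sum_Pow_prod:
  fixes f g :: "'a \<Rightarrow> real"
  assumes "finite Y"
  shows "(\<Sum>S\<in>Pow Y. \<Prod>y\<in>Y. if y \<in> S then f y else g y) = (\<Prod>y\<in>Y. f y + g y)"
proof -
  have "(\<Prod>y\<in>Y. if y \<in> S then f y else g y) = prod f S * prod g (Y - S)" if "S \<subseteq> Y" for S
  proof -
    have "Y \<inter> S = S" "Y \<inter> - S = Y - S" using that by auto
    then show ?thesis using prod.If_cases[OF assms, of "\<lambda>y. y \<in> S" f g] by simp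
  qed
  then show ?thesis unfolding prod_add[OF assms] by (intro sum.cong) auto
qed

text \<open>The exponential factors over the coordinates, so summing over all sign vectors gives a
  product of factors 2 cosh(a), whatever \<open>S\<close> is.\<close>

lemma sum_exp_sgn_in_le:
  assumes "finite Y"
  shows "(\<Sum>S'\<in>Pow Y. exp (a * (\<Sum>y\<in>Y. sgn_in S y * sgn_in S' y)))
       \<le> 2 ^ card Y * exp (real (card Y) * a\<^sup>2 / 2)"
proof -
  have "exp (a * (\<Sum>y\<in>Y. sgn_in S y * sgn_in S' y))
      = (\<Prod>y\<in>Y. if y \<in> S' then exp (a * sgn_in S y) else exp (- (a * sgn_in S y)))" for S'
    unfolding sum_distrib_left exp_sum[OF assms] by (intro prod.cong) (auto simp: sgn_in_def)
  then have "(\<Sum>S'\<in>Pow Y. exp (a * (\<Sum>y\<in>Y. sgn_in S y * sgn_in S' y)))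
      = (\<Prod>y\<in>Y. exp (a * sgn_in S y) + exp (- (a * sgn_in S y)))"
    by (simp add: sum_Pow_prod[OF assms])
  also have "\<dots> \<le> (\<Prod>y\<in>Y. 2 * exp (a\<^sup>2 / 2))"
  proof (intro prod_mono conjI)
    show "exp (a * sgn_in S y) + exp (- (a * sgn_in S y)) \<le> 2 * exp (a\<^sup>2 / 2)" for y
      using cosh_le_exp_square[of a] by (auto simp: sgn_in_def add.commute)
  qed (auto intro: add_nonneg_nonneg)
  also have "\<dots> = 2 ^ card Y * exp (real (card Y) * a\<^sup>2 / 2)"
    by (simp add: power_mult_distrib exp_of_nat_mult[symmetric])
  finally show ?thesis .
qed

text \<open>For each fixed \<open>S\<close>, the sum over \<open>S'\<close> is an exponential moment
  of a sum of independent signs, taken at \<open>a = q * \<delta>^2 / 2^k\<close>; the bound does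
  not depend on \<open>S\<close>.\<close>

lemma perturbed_chi_square_le:
  fixes k q :: nat
  assumes "0 \<le> \<delta>" "\<delta> \<le> 1"
  defines "Z \<equiv> Pow (cube k)"
  shows "(\<Sum>S\<in>Z. \<Sum>S'\<in>Z. (2 ^ Suc k * (\<Sum>x\<in>cube (Suc k).
            pmf (perturbed k \<delta> S) x * pmf (perturbed k \<delta> S') x)) ^ q) / (real (card Z))\<^sup>2
       \<le> exp ((real q * \<delta>\<^sup>2)\<^sup>2 / 2 ^ Suc k)"
proof -
  have cZ: "real (card Z) = 2 ^ 2 ^ k" by (simp add: Z_def card_Pow)
  have "(\<Sum>S\<in>Z. \<Sum>S'\<in>Z. (2 ^ Suc k * (\<Sum>x\<in>cube (Suc k).
            pmf (perturbed k \<delta> S) x * pmf (perturbed k \<delta> S') x)) ^ q)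
      \<le> (\<Sum>S\<in>Z. \<Sum>S'\<in>Z. exp (real q * \<delta>\<^sup>2 / 2 ^ k * (\<Sum>y\<in>cube k. sgn_in S y * sgn_in S' y)))"
    using assms by (intro sum_mono perturbed_inner_product_power_le)
  also have "\<dots> \<le> (\<Sum>S\<in>Z. 2 ^ 2 ^ k * exp (2 ^ k * (real q * \<delta>\<^sup>2 / 2 ^ k)\<^sup>2 / 2))"
    using sum_exp_sgn_in_le[OF finite_cube[of k], where a = "real q * \<delta>\<^sup>2 / 2 ^ k"] unfolding Z_def
    by (intro sum_mono) (simp only: card_cube of_nat_power of_nat_numeral)
  also have "\<dots> = (real (card Z))\<^sup>2 * exp (2 ^ k * (real q * \<delta>\<^sup>2 / 2 ^ k)\<^sup>2 / 2)"
    by (simp add: cZ power2_eq_square)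
  also have "2 ^ k * (real q * \<delta>\<^sup>2 / 2 ^ k)\<^sup>2 / 2 = (real q * \<delta>\<^sup>2)\<^sup>2 / 2 ^ Suc k"
    by (simp add: power2_eq_square)
  finally show ?thesis using cZ by (simp add: divide_le_eq mult.commute)
qed

section \<open>Volume of Hamming balls\<close>

text \<open>Exponential Markov argument: weight each set by 1/16 to the power of its distance from
  the centre. Each member of the ball weighs at least \<open>(1/16) ^ d\<close>, while the total
  weight is (17/16)^(8d), at most 2^d because (17/16)^8 is below 2.\<close>

lemma card_Hamming_ball_le:
  assumes "finite Y" "card Y = 8 * d"
  shows "card {S\<in>Pow Y. card {y\<in>Y. (y \<in> S) \<noteq> (y \<in> S\<^sub>0)} \<le> d} \<le> 32 ^ d"
proof -
  let ?B = "{S\<in>Pow Y. card {y\<in>Y. (y \<in> S) \<noteq> (y \<in> S\<^sub>0)} \<le> d}"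
  let ?w = "\<lambda>S. \<Prod>y\<in>Y. if (y \<in> S) \<noteq> (y \<in> S\<^sub>0) then 1/16 else (1::real)"
  have "real (card ?B) * (1/16) ^ d = (\<Sum>S\<in>?B. (1/16) ^ d)" by simp
  also have "\<dots> \<le> (\<Sum>S\<in>?B. ?w S)"
  proof (rule sum_mono)
    fix S assume "S \<in> ?B"
    then have "(1/16 :: real) ^ d \<le> (1/16) ^ card {y\<in>Y. (y \<in> S) \<noteq> (y \<in> S\<^sub>0)}"
      by (intro power_decreasing) auto
    also have "\<dots> = ?w S"
      by (subst prod.inter_filter[OF assms(1), symmetric]) simp
    finally show "(1/16) ^ d \<le> ?w S" .
  qed
  also have "\<dots> \<le> (\<Sum>S\<in>Pow Y. ?w S)"
    using assms by (intro sum_mono2) (auto intro!: prod_nonneg)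
  also have "\<dots> = (\<Sum>S\<in>Pow Y. \<Prod>y\<in>Y. if y \<in> S then (if y \<in> S\<^sub>0 then 1 else 1/16)
                                         else (if y \<in> S\<^sub>0 then 1/16 else 1))"
    by (intro sum.cong prod.cong) auto
  also have "\<dots> = (\<Prod>y\<in>Y. 17/16)"
    unfolding sum_Pow_prod[OF assms(1)] by (intro prod.cong) auto
  also have "\<dots> = ((17/16) ^ 8) ^ d"
    by (simp add: assms(2) power_mult)
  also have "\<dots> \<le> 2 ^ d"
    by (intro power_mono) (simp_all add: power_divide)
  finally have "real (card ?B) \<le> 2 ^ d * 16 ^ d" by (simp add: power_divide field_simps)
  also have "\<dots> = real (32 ^ d)" by (simp add: power_mult_distrib[symmetric])
  finally show ?thesis by (simp only: of_nat_le_iff)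
qed

section \<open>What a tester forces\<close>

text \<open>A tester rejects the uniform distribution with probability at most 1/3, but the mixture
  with probability at least 7/12. The gap 1/4 makes the chi-square divergence at least 1/16; the
  quotient in the conclusion is that divergence plus 1.\<close>

lemma tester_chi_square_ge:
  fixes P :: "'z \<Rightarrow> bool list pmf"
  assumes T: "tester n C \<epsilon> q T" and U: "pmf_of_set (cube n) \<in> C"
    and Z: "finite Z" "Z \<noteq> {}" "\<And>z. z \<in> Z \<Longrightarrow> P z \<in> dists n"
    and F: "F \<subseteq> Z" "7 * card Z \<le> 8 * card F" "\<And>z. z \<in> F \<Longrightarrow> far_from n \<epsilon> (P z) C"
  shows "17/16 \<le> (\<Sum>z\<in>Z. \<Sum>z'\<in>Z. (2 ^ n * (\<Sum>x\<in>cube n. pmf (P z) x * pmf (P z') x)) ^ q)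
                 / (real (card Z))\<^sup>2"
proof -
  define W where "W = samples n q"
  define p where "p R xs = prod_list (map (pmf R) xs)" for R :: "bool list pmf" and xs
  define f where "f xs = pmf (T xs) False" for xs
  define rej where "rej R = (\<Sum>xs\<in>W. p R xs * f xs)" for R
  let ?U = "pmf_of_set (cube n)"
  have rej: "rej R = pmf (bind_pmf (replicate_pmf q R) T) False" if "R \<in> dists n" for R
    unfolding rej_def f_def p_def W_def by (rule pmf_bind_replicate_pmf[OF that, symmetric])
  have p1: "(\<Sum>xs\<in>W. p R xs) = 1" if "R \<in> dists n" for R
    unfolding p_def W_def sum_samples_prod_list using sum_pmf_cube[OF that] by simp
  \<comment> \<open>Each uniform mass is 1/2^n, so the likelihood products factor over the entries
    of the list.\<close>
  have inner: "p R xs * p R' xs / p ?U xs = prod_list (map (\<lambda>x. 2 ^ n * (pmf R x * pmf R' x)) xs)"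
    if "xs \<in> W" for R R' xs
  proof -
    have "set xs \<subseteq> cube n" using that by (simp add: W_def samples_def)
    then show ?thesis
    proof (induction xs)
      case (Cons x xs)
      have "p R (x # xs) * p R' (x # xs) / p ?U (x # xs)
          = (2 ^ n * (pmf R x * pmf R' x)) * (p R xs * p R' xs / p ?U xs)"
        using Cons.prems by (simp add: p_def)
      also have "p R xs * p R' xs / p ?U xs = prod_list (map (\<lambda>x. 2 ^ n * (pmf R x * pmf R' x)) xs)"
        using Cons by simp
      finally show ?case by simp
    qed (simp add: p_def)
  qed
  have U_pos: "0 < p ?U xs" if "xs \<in> W" for xs
  proof -
    have "set xs \<subseteq> cube n" using that by (simp add: W_def samples_def)
    then show ?thesis by (induction xs) (auto simp: p_def)
  qed
  have cZ: "real (card Z) > 0" using Z by (simp add: card_gt_0_iff)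
  have rej_far: "2/3 \<le> rej (P z)" if "z \<in> F" for z
    using T F(1,3) Z(3) that by (auto simp: tester_def rej)
  \<comment> \<open>The far members alone contribute 2/3 * 7/8 = 7/12 on average; the others
    contribute at least 0.\<close>
  have "2/3 * (7/8 * card Z) \<le> 2/3 * card F" using F(2) by simp
  also have "\<dots> = (\<Sum>z\<in>F. 2/3)" by simp
  also have "\<dots> \<le> (\<Sum>z\<in>F. rej (P z))" by (intro sum_mono rej_far)
  also have "\<dots> \<le> (\<Sum>z\<in>Z. rej (P z))"
    using Z F(1) by (intro sum_mono2) (auto simp: rej)
  finally have mix: "7/12 \<le> (\<Sum>z\<in>Z. rej (P z)) / card Z"
    using cZ by (simp add: field_simps)
  have "pmf (bind_pmf (replicate_pmf q ?U) T) True \<ge> 2/3"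
    using T U uniform_in_dists by (auto simp: tester_def)
  then have unif: "rej ?U \<le> 1/3"
    using pmf_False_conv_True[of "bind_pmf (replicate_pmf q ?U) T"] by (simp add: rej uniform_in_dists)
  have "(1/4)\<^sup>2 \<le> ((\<Sum>z\<in>Z. rej (P z)) / card Z - rej ?U)\<^sup>2"
    using mix unif by (intro power_mono; linarith)
  also have "\<dots> \<le> (\<Sum>z\<in>Z. \<Sum>z'\<in>Z. \<Sum>xs\<in>W. p (P z) xs * p (P z') xs / p ?U xs)
                / (real (card Z))\<^sup>2 - 1"
    unfolding rej_def using Z p1 uniform_in_dists U_pos
    by (intro mixture_chi_square_bound) (auto simp: W_def f_def pmf_le_1)
  finally show ?thesis
    by (simp add: inner W_def sum_samples_prod_list sum_distrib_left power_divide cong: sum.cong)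
qed

section \<open>What a learner forces\<close>

text \<open>The list \<open>a Q\<close> exists since success at most 1/2 on every list would average
  to less than 2/3. For \<open>a Q = a Q'\<close> two events of probability above 1/2 under one law
  meet in some \<open>H\<close>, and the chain \<open>P\<close>, \<open>Q\<close>, \<open>H\<close>,
  \<open>Q'\<close>, \<open>P'\<close> has four steps shorter than \<epsilon>.\<close>

lemma learner_imp_cover:
  assumes L: "learner n C \<epsilon> m L" and C: "C \<subseteq> dists n"
  obtains a where "\<And>Q. Q \<in> C \<Longrightarrow> a Q \<in> samples n m"
    and "\<And>P P' Q Q'. Q \<in> C \<Longrightarrow> Q' \<in> C \<Longrightarrow> a Q = a Q' \<Longrightarrow>
      dTV n P Q < \<epsilon> \<Longrightarrow> dTV n P' Q' < \<epsilon> \<Longrightarrow> dTV n P P' < 4 * \<epsilon>"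
proof -
  let ?good = "\<lambda>Q. {H. dTV n H Q < \<epsilon>}"
  have ex: "\<exists>xs\<in>samples n m. measure_pmf.prob (L xs) (?good Q) > 1/2" if Q: "Q \<in> C" for Q
  proof (rule ccontr)
    assume "\<not> ?thesis"
    then have le: "measure_pmf.prob (L xs) (?good Q) \<le> 1/2" if "xs \<in> samples n m" for xs
      using that by force
    have "ennreal (2/3) \<le> emeasure (bind_pmf (replicate_pmf m Q) L) (?good Q)"
      using L Q by (auto simp: learner_def measure_pmf.emeasure_eq_measure intro!: ennreal_leI)
    also have "\<dots> = (\<integral>\<^sup>+xs. emeasure (L xs) (?good Q) \<partial>replicate_pmf m Q)"
      by simp
    also have "\<dots> \<le> (\<integral>\<^sup>+xs. ennreal (1/2) \<partial>replicate_pmf m Q)"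
    proof (intro nn_integral_mono_AE, unfold AE_measure_pmf_iff, intro ballI)
      fix xs assume "xs \<in> set_pmf (replicate_pmf m Q)"
      then have "xs \<in> samples n m" using set_replicate_pmf_subset Q C by blast
      then show "emeasure (L xs) (?good Q) \<le> ennreal (1/2)"
        unfolding measure_pmf.emeasure_eq_measure by (intro ennreal_leI le)
    qed
    also have "\<dots> = ennreal (1/2)" by simp
    finally show False by (subst (asm) ennreal_le_iff) auto
  qed
  then obtain a where a: "\<And>Q. Q \<in> C \<Longrightarrow> a Q \<in> samples n m"
      "\<And>Q. Q \<in> C \<Longrightarrow> measure_pmf.prob (L (a Q)) (?good Q) > 1/2"
    by metis
  moreover have "dTV n P P' < 4 * \<epsilon>" if "Q \<in> C" "Q' \<in> C" "a Q = a Q'"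
    "dTV n P Q < \<epsilon>" "dTV n P' Q' < \<epsilon>" for P P' Q Q'
  proof -
    let ?M = "L (a Q)"
    have "?good Q \<inter> ?good Q' \<noteq> {}"
    proof
      assume "?good Q \<inter> ?good Q' = {}"
      then have "measure_pmf.prob ?M (?good Q \<union> ?good Q')
          = measure_pmf.prob ?M (?good Q) + measure_pmf.prob ?M (?good Q')"
        by (intro measure_pmf.finite_measure_Union) auto
      then show False
        using a(2)[OF that(1)] a(2)[OF that(2)] that(3) measure_pmf.prob_le_1[of ?M "?good Q \<union> ?good Q'"]
        by simp
    qed
    then obtain H where "dTV n H Q < \<epsilon>" "dTV n H Q' < \<epsilon>" by blast
    then show ?thesis
      using that(4,5) dTV_triangle[of n P P' Q] dTV_triangle[of n Q P' H] dTV_triangle[of n H P' Q']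
      by (simp add: dTV_commute[of n Q H] dTV_commute[of n P' Q'])
  qed
  ultimately show ?thesis using that by blast
qed

text \<open>Group the sign choices that are not far by the list of a nearby member of
  \<open>C\<close>. Within a group distances are below 4\<epsilon>, which for \<delta> =
  32\<epsilon> means fewer than 2^k / 8 = d differing signs, so each group lies in a Hamming
  ball.\<close>

lemma card_not_far_le:
  assumes L: "learner (Suc k) C \<epsilon> m L" and C: "C \<subseteq> dists (Suc k)" and "0 < \<epsilon>" "\<epsilon> \<le> 1/32"
    and k: "2 ^ k = 8 * d"
  shows "card {S\<in>Pow (cube k). \<not> far_from (Suc k) \<epsilon> (perturbed k (32 * \<epsilon>) S) C}
       \<le> 2 ^ (Suc k * m) * 32 ^ d"
proof -
  let ?P = "perturbed k (32 * \<epsilon>)"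
  let ?B = "{S\<in>Pow (cube k). \<not> far_from (Suc k) \<epsilon> (?P S) C}"
  obtain a where a: "\<And>Q. Q \<in> C \<Longrightarrow> a Q \<in> samples (Suc k) m"
    "\<And>P P' Q Q'. Q \<in> C \<Longrightarrow> Q' \<in> C \<Longrightarrow> a Q = a Q' \<Longrightarrow>
      dTV (Suc k) P Q < \<epsilon> \<Longrightarrow> dTV (Suc k) P' Q' < \<epsilon> \<Longrightarrow> dTV (Suc k) P P' < 4 * \<epsilon>"
    using learner_imp_cover[OF L C] by blast
  have "\<forall>S\<in>?B. \<exists>Q\<in>C. dTV (Suc k) (?P S) Q < \<epsilon>" by (auto simp: far_from_def not_le)
  then obtain N where N: "\<forall>S\<in>?B. N S \<in> C \<and> dTV (Suc k) (?P S) (N S) < \<epsilon>"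
    unfolding Bex_def by (rule bchoice[THEN exE])
  have fiber: "card {S\<in>?B. a (N S) = w} \<le> 32 ^ d" for w
  proof (cases "{S\<in>?B. a (N S) = w} = {}")
    case False
    then obtain S\<^sub>0 where S0: "S\<^sub>0 \<in> ?B" "a (N S\<^sub>0) = w" by blast
    have "card {y\<in>cube k. (y \<in> S) \<noteq> (y \<in> S\<^sub>0)} \<le> d" if S: "S \<in> ?B" "a (N S) = w" for S
    proof -
      have "dTV (Suc k) (?P S) (?P S\<^sub>0) < 4 * \<epsilon>"
        using S S0 N by (intro a(2)[of "N S" "N S\<^sub>0"]) auto
      then have "32 * \<epsilon> * card {y\<in>cube k. (y \<in> S) \<noteq> (y \<in> S\<^sub>0)} / 2 ^ k < 4 * \<epsilon>"
        using assms by (subst (asm) dTV_perturbed) auto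
      then have "real (8 * card {y\<in>cube k. (y \<in> S) \<noteq> (y \<in> S\<^sub>0)}) < real (2 ^ k)"
        using \<open>0 < \<epsilon>\<close> by (simp add: field_simps)
      then show ?thesis unfolding of_nat_less_iff k by simp
    qed
    then have "card {S\<in>?B. a (N S) = w}
        \<le> card {S\<in>Pow (cube k). card {y\<in>cube k. (y \<in> S) \<noteq> (y \<in> S\<^sub>0)} \<le> d}"
      by (intro card_mono) auto
    also have "\<dots> \<le> 32 ^ d" using k by (intro card_Hamming_ball_le) auto
    finally show ?thesis .
  next
    case True
    then show ?thesis by (simp only: card.empty)
  qed
  have "card ?B = card (\<Union>w\<in>samples (Suc k) m. {S\<in>?B. a (N S) = w})"
    using a(1) N(1) by (intro arg_cong[where f = card]) auto
  also have "\<dots> \<le> (\<Sum>w\<in>samples (Suc k) m. card {S\<in>?B. a (N S) = w})"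
    by (rule card_UN_le) simp
  also have "\<dots> \<le> (\<Sum>w\<in>samples (Suc k) m. 32 ^ d)"
    by (rule sum_mono) (rule fiber)
  finally show ?thesis by (simp only: sum_constant card_samples of_nat_id)
qed

text \<open>
  With at most two sample lists, the pairwise distant distributions uniform,
  \<open>perturbed k \<delta> {}\<close> and \<open>perturbed k \<delta> (cube k)\<close> cannot all be close to \<open>C\<close>.
\<close>

lemma extreme_perturbation_far:
  assumes L: "learner (Suc k) C \<epsilon> m L" and C: "C \<subseteq> dists (Suc k)" "pmf_of_set (cube (Suc k)) \<in> C"
    and "0 < \<epsilon>" "\<epsilon> \<le> 1/32" and m: "Suc k * m \<le> 1"
  shows "\<exists>S\<subseteq>cube k. far_from (Suc k) \<epsilon> (perturbed k (32 * \<epsilon>) S) C"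
proof (rule ccontr)
  assume none: "\<not> ?thesis"
  let ?P = "perturbed k (32 * \<epsilon>)" and ?U = "pmf_of_set (cube (Suc k))"
  obtain a where a: "\<And>Q. Q \<in> C \<Longrightarrow> a Q \<in> samples (Suc k) m"
    "\<And>P P' Q Q'. Q \<in> C \<Longrightarrow> Q' \<in> C \<Longrightarrow> a Q = a Q' \<Longrightarrow>
      dTV (Suc k) P Q < \<epsilon> \<Longrightarrow> dTV (Suc k) P' Q' < \<epsilon> \<Longrightarrow> dTV (Suc k) P P' < 4 * \<epsilon>"
    using learner_imp_cover[OF L C(1)] by blast
  have ex: "\<exists>Q\<in>C. dTV (Suc k) (?P S) Q < \<epsilon>" if "S \<subseteq> cube k" for S
  proof -
    have "\<not> far_from (Suc k) \<epsilon> (?P S) C" using none that by blast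
    then show ?thesis by (auto simp: far_from_def not_le)
  qed
  obtain Q1 where Q1: "Q1 \<in> C" "dTV (Suc k) (?P {}) Q1 < \<epsilon>" using ex by blast
  obtain Q2 where Q2: "Q2 \<in> C" "dTV (Suc k) (?P (cube k)) Q2 < \<epsilon>" using ex by blast
  have U: "dTV (Suc k) ?U ?U < \<epsilon>" using \<open>0 < \<epsilon>\<close> by (simp add: dTV_def)
  have "card {a ?U, a Q1, a Q2} \<le> 2"
  proof -
    have "card {a ?U, a Q1, a Q2} \<le> card (samples (Suc k) m)"
      using a(1) C(2) Q1 Q2 by (intro card_mono) auto
    also have "\<dots> \<le> 2 ^ 1" unfolding card_samples using m by (intro power_increasing) auto
    finally show ?thesis by simp
  qed
  then have "a ?U = a Q1 \<or> a ?U = a Q2 \<or> a Q1 = a Q2"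
    by (auto simp: card_insert_if split: if_splits)
  \<comment> \<open>The distances are 16\<epsilon> from uniform and 32\<epsilon> between the two
    extremes, both at least 4\<epsilon>.\<close>
  moreover have "\<not> dTV (Suc k) ?U (?P S) < 4 * \<epsilon>" for S
    using assms by (subst dTV_perturbed_uniform) auto
  moreover have "\<not> dTV (Suc k) (?P {}) (?P (cube k)) < 4 * \<epsilon>"
    using assms by (subst dTV_perturbed) (auto simp: cong: conj_cong)
  ultimately show False
    using a(2)[OF C(2) Q1(1) _ U Q1(2)] a(2)[OF C(2) Q2(1) _ U Q2(2)] a(2)[OF Q1(1) Q2(1) _ Q1(2) Q2(2)]
    by blast
qed

section \<open>Choice of constants and the two ranges of dimension\<close>

theorem theoremB1:
  shows "\<exists>\<rho>>0. \<exists>c>0. \<exists>\<epsilon>\<^sub>0>0.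
    \<forall>(n::nat) (\<epsilon>::real) (C::bool list pmf set) (m::nat) (q::nat).
      n \<ge> 1 \<longrightarrow> 0 < \<epsilon> \<longrightarrow> \<epsilon> \<le> \<epsilon>\<^sub>0 \<longrightarrow>
      C \<subseteq> dists n \<longrightarrow>
      pmf_of_set (cube n) \<in> C \<longrightarrow>
      (\<exists>L. learner n C \<epsilon> m L) \<longrightarrow>
      real m * real n \<le> 2 powr (\<rho> * real n) \<longrightarrow>
      (\<forall>T. tester n C \<epsilon> q T \<longrightarrow>
         real q \<ge> c * (2 powr (real n / 2) / \<epsilon>^2))"
proof -
  \<comment> \<open>Here 524288 = 512 * 32^2 absorbs the square of \<delta> = 32\<epsilon>, and
    \<epsilon> \<le> 1/32 keeps \<delta> at most 1.\<close>
  have bound: "1/524288 * (2 powr (real n / 2) / \<epsilon>\<^sup>2) \<le> real q"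
    if n: "1 \<le> n" and \<epsilon>: "0 < \<epsilon>" "\<epsilon> \<le> 1/32" and C: "C \<subseteq> dists n" "pmf_of_set (cube n) \<in> C"
      and L: "learner n C \<epsilon> m L" and mn: "real m * real n \<le> 2 powr (1/8 * real n)"
      and T: "tester n C \<epsilon> q T"
    for n m q :: nat and \<epsilon> C L T
  proof (rule ccontr)
    assume "\<not> ?thesis"
    then have "real q < 1/524288 * (2 powr (real n / 2) / \<epsilon>\<^sup>2)" by simp
    then have q: "real q * (32 * \<epsilon>)\<^sup>2 < 2 powr (real n / 2) / 512"
      using \<epsilon> by (simp add: field_simps power2_eq_square)
    obtain k where k: "n = Suc k" using n by (cases n) auto
    have \<delta>: "0 \<le> 32 * \<epsilon>" "32 * \<epsilon> \<le> 1" using \<epsilon> by auto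
    let ?P = "perturbed k (32 * \<epsilon>)"
    let ?ip = "\<lambda>S S'. (2 ^ Suc k * (\<Sum>x\<in>cube (Suc k). pmf (?P S) x * pmf (?P S') x)) ^ q"
    \<comment> \<open>The value 17/16 is the lower bound that a tester forces, so a chi-square
      exponent below 1/32 is contradictory.\<close>
    have exp32: "exp x < 17/16" if "x < 1/32" for x :: real
    proof -
      have "exp x < exp (1/32)" using that by simp
      also have "\<dots> \<le> 1 + 2 * (1/32)" by (rule real_exp_bound_lemma) auto
      finally show ?thesis by simp
    qed
    show False
    proof (cases "n \<le> 7")
      case True
      have "(2::real) powr (1/8 * real n) < 2 powr 1" using True by (intro powr_less_mono) auto
      then have "real (m * n) < real 2" using mn by simp
      then have "m * n < 2" by (simp only: of_nat_less_iff)
      then have "Suc k * m \<le> 1" by (simp add: k mult.commute)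
      then obtain S where S: "far_from (Suc k) \<epsilon> (?P S) C"
        using extreme_perturbation_far L C \<epsilon> unfolding k by blast
      \<comment> \<open>The mixture is a single far distribution. Its self-correlation is full, so
        the exponent is q\<delta>^2, which is below 2^4 / 512 = 1/32 in this range.\<close>
      have "17/16 \<le> (\<Sum>z\<in>{S}. \<Sum>z'\<in>{S}. ?ip z z') / (real (card {S}))\<^sup>2"
        using T C S \<delta> unfolding k
        by (intro tester_chi_square_ge[where F = "{S}"]) (auto simp: perturbed_in_dists)
      also have "\<dots> \<le> exp (real q * (32 * \<epsilon>)\<^sup>2 / 2 ^ k * (\<Sum>y\<in>cube k. sgn_in S y * sgn_in S y))"
        using perturbed_inner_product_power_le[OF \<delta>] by simp
      also have "(\<Sum>y\<in>cube k. sgn_in S y * sgn_in S y) = (\<Sum>y\<in>cube k. 1)"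
        by (rule sum.cong) (auto simp: sgn_in_def)
      also have "real q * (32 * \<epsilon>)\<^sup>2 / 2 ^ k * \<dots> = real q * (32 * \<epsilon>)\<^sup>2" by simp
      also have "exp \<dots> < 17/16"
      proof (rule exp32)
        have "(2::real) powr (real n / 2) \<le> 2 powr 4" using True by (intro powr_mono) auto
        then show "real q * (32 * \<epsilon>)\<^sup>2 < 1/32" using q by simp
      qed
      finally show False by simp
    next
      case False
      \<comment> \<open>One eighth of the number of pairs, the Hamming radius;
        \<open>n \<ge> 8\<close> gives \<open>k \<ge> 7\<close>, hence \<open>d \<ge> 16\<close> and
        n/8 \<le> k - 3.\<close>
      define d :: nat where "d = 2 ^ (k - 3)"
      have d: "2 ^ k = 8 * d"
        using False k power_add[of "2::nat" 3 "k - 3"] by (simp add: d_def)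
      have "(2::nat) ^ 4 \<le> d" unfolding d_def using False k by (intro power_increasing) auto
      have "real (m * n) \<le> 2 powr (1/8 * real n)" using mn by simp
      also have "\<dots> \<le> 2 powr real (k - 3)" using False k by (intro powr_mono) auto
      also have "\<dots> = real d" by (simp add: d_def powr_realpow)
      finally have mnd: "m * n \<le> d" by (simp only: of_nat_le_iff)
      define Z where "Z = Pow (cube k)"
      define B where "B = {S\<in>Z. \<not> far_from (Suc k) \<epsilon> (?P S) C}"
      have "8 * card B \<le> 2 ^ 3 * (2 ^ (Suc k * m) * 2 ^ (5 * d))"
        using card_not_far_le[OF _ _ _ _ d] L C \<epsilon> unfolding k B_def Z_def by (simp add: power_mult)
      also have "\<dots> = 2 ^ (3 + (Suc k * m + 5 * d))" by (simp only: power_add)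
      \<comment> \<open>The exponent is at most 3 + d + 5d, which is below 8d = 2^k.\<close>
      also have "\<dots> \<le> 2 ^ (2 ^ k)"
        using mnd \<open>2 ^ 4 \<le> d\<close> unfolding d k by (intro power_increasing) (auto simp: mult.commute)
      also have "\<dots> = card Z" by (simp add: Z_def card_Pow)
      finally have B: "8 * card B \<le> card Z" .
      have fin: "finite Z" "Z \<noteq> {}" "B \<subseteq> Z" by (auto simp: Z_def B_def)
      have "17/16 \<le> (\<Sum>S\<in>Z. \<Sum>S'\<in>Z. ?ip S S') / (real (card Z))\<^sup>2"
      proof (rule tester_chi_square_ge[where F = "Z - B"])
        show "tester (Suc k) C \<epsilon> q T" "pmf_of_set (cube (Suc k)) \<in> C" using T C k by auto
        show "7 * card Z \<le> 8 * card (Z - B)"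
          using B fin by (simp add: card_Diff_subset finite_subset[OF fin(3,1)])
      qed (use fin \<delta> in \<open>auto simp: B_def perturbed_in_dists\<close>)
      also have "\<dots> \<le> exp ((real q * (32 * \<epsilon>)\<^sup>2)\<^sup>2 / 2 ^ Suc k)"
        unfolding Z_def by (rule perturbed_chi_square_le[OF \<delta>])
      also have "\<dots> < 17/16"
      proof (rule exp32)
        \<comment> \<open>Squaring turns 2^(n/2) into 2^n, which the denominator cancels, leaving
          1/512^2.\<close>
        have "(real q * (32 * \<epsilon>)\<^sup>2)\<^sup>2 \<le> (2 powr (real n / 2) / 512)\<^sup>2"
          using q by (intro power_mono) auto
        also have "\<dots> = 2 ^ Suc k / 512\<^sup>2"
          by (simp add: power_divide powr_power powr_realpow k del: power_Suc flip: of_nat_Suc)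
        finally have "(real q * (32 * \<epsilon>)\<^sup>2)\<^sup>2 / 2 ^ Suc k \<le> 2 ^ Suc k / 512\<^sup>2 / 2 ^ Suc k"
          by (rule divide_right_mono) simp
        also have "\<dots> < 1/32" by simp
        finally show "(real q * (32 * \<epsilon>)\<^sup>2)\<^sup>2 / 2 ^ Suc k < 1/32" .
      qed
      finally show False by simp
    qed
  qed
  show ?thesis
    by (rule exI[of _ "1/8"], rule conjI, simp, rule exI[of _ "1/524288"], rule conjI, simp,
        rule exI[of _ "1/32"], rule conjI, simp) (use bound in blast)
qed

end
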